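(* Let $R$ be a $2$-simple Ore domain of stable range $1$. For each matrix $A\in R^{2\times 2}$ that is a non-zero divisor (in the ring $R^{2\times 2}$) there exist $P,Q\in GL_2(R)$ such that $$PAQ=\begin{pmatrix}1&0\\0&a\end{pmatrix}\quad\text{for some } a\in R.$$
   Context: Rings are associative (not necessarily commutative) with nonzero unit. $R^{r\times s}$ denotes the set of $r\times s$ matrices over $R$, and $GL_n(R)$ is the group of units of $R^{n\times n}$. A domain $R$ is a right (left) Ore domain if $aR\cap bR\ne\{0\}$ (respectively $Ra\cap Rb\neq\{0\}$) for all $a,b\in R\setminus\{0\}$; an Ore domain is a domain that is both right and left Ore. A ring $R$ is simple if it has no two-sided ideals other than $0$ and $R$. A simple ring $R$ is called $n$-simple ($n\in\mathbb{N}$, $n\ge1$) if $n$ is the minimal positive integer such that for every $a\in R\setminus\{0\}$ there exist $u_1,\ldots,u_n,v_1,\ldots,v_n\in R$ with $u_1av_1+\cdots+u_nav_n=1$. A ring $R$ has stable range $1$ if for all $a,b\in R$, $aR+bR=R$ implies $(a+bt)R=R$ for some $t\in R$. *)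

theory Defs
  imports "HOL-Analysis.Cartesian_Space"
begin

text \<open>
  Ring-level notions are predicates on the type of the ring. Classes with suffix \<open>1\<close> include
  \<open>0 \<noteq> 1\<close>, and none of the classes used here makes multiplication commutative; in particular
  \<^class>\<open>ring_1_no_zero_divisors\<close> is the class of (not necessarily commutative) domains.
\<close>

definition two_sided_ideal :: "'a::ring_1 set \<Rightarrow> bool" where
  "two_sided_ideal I \<longleftrightarrow>
     0 \<in> I \<and> (\<forall>x\<in>I. \<forall>y\<in>I. x - y \<in> I) \<and> (\<forall>x\<in>I. \<forall>r. r * x \<in> I \<and> x * r \<in> I)"

definition simple_ring :: "'a::ring_1 itself \<Rightarrow> bool" where
  "simple_ring _ \<longleftrightarrow> (\<forall>I :: 'a set. two_sided_ideal I \<longrightarrow> I = {0} \<or> I = UNIV)"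

definition unit_as_n_term_sum :: "'a::ring_1 itself \<Rightarrow> nat \<Rightarrow> bool" where
  "unit_as_n_term_sum _ n \<longleftrightarrow>
     (\<forall>a :: 'a. a \<noteq> 0 \<longrightarrow> (\<exists>u v :: nat \<Rightarrow> 'a. (\<Sum>i<n. u i * a * v i) = 1))"

definition n_simple :: "nat \<Rightarrow> 'a::ring_1 itself \<Rightarrow> bool" where
  "n_simple n R \<longleftrightarrow> simple_ring R \<and> n \<ge> 1 \<and> unit_as_n_term_sum R n \<and>
     (\<forall>m. 1 \<le> m \<and> m < n \<longrightarrow> \<not> unit_as_n_term_sum R m)"

text \<open>The right ideal \<open>aR\<close> is \<open>range (\<lambda>r. a * r)\<close>, the left ideal \<open>Ra\<close> is \<open>range (\<lambda>r. r * a)\<close>.\<close>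

definition right_ore_domain :: "'a::ring_1_no_zero_divisors itself \<Rightarrow> bool" where
  "right_ore_domain _ \<longleftrightarrow>
     (\<forall>a b :: 'a. a \<noteq> 0 \<and> b \<noteq> 0 \<longrightarrow> range (\<lambda>r. a * r) \<inter> range (\<lambda>r. b * r) \<noteq> {0})"

definition left_ore_domain :: "'a::ring_1_no_zero_divisors itself \<Rightarrow> bool" where
  "left_ore_domain _ \<longleftrightarrow>
     (\<forall>a b :: 'a. a \<noteq> 0 \<and> b \<noteq> 0 \<longrightarrow> range (\<lambda>r. r * a) \<inter> range (\<lambda>r. r * b) \<noteq> {0})"

definition ore_domain :: "'a::ring_1_no_zero_divisors itself \<Rightarrow> bool" where
  "ore_domain R \<longleftrightarrow> right_ore_domain R \<and> left_ore_domain R"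

definition stable_range_1 :: "'a::ring_1 itself \<Rightarrow> bool" where
  "stable_range_1 _ \<longleftrightarrow>
     (\<forall>a b :: 'a. {a * x + b * y | x y. True} = UNIV \<longrightarrow>
        (\<exists>t. range (\<lambda>r. (a + b * t) * r) = UNIV))"

text \<open>
  The instance of \<open>*\<close> on \<^typ>\<open>'a ^ 'n ^ 'n\<close> is componentwise, so notions of the matrix ring
  have to be stated with \<open>**\<close>. Non-zero divisors are neither left nor right zero divisors.
\<close>

definition matrix_non_zero_divisor :: "'a::ring_1 ^ 'n ^ 'n \<Rightarrow> bool" where
  "matrix_non_zero_divisor A \<longleftrightarrow>
     (\<forall>B :: 'a ^ 'n ^ 'n. A ** B = 0 \<longrightarrow> B = 0) \<and> (\<forall>B :: 'a ^ 'n ^ 'n. B ** A = 0 \<longrightarrow> B = 0)"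

end

theory Submission
  imports Defs
begin

text \<open>
  It suffices to find a row \<open>u\<close> and a column \<open>w\<close> with \<open>u A w = 1\<close>. Such a \<open>u\<close> generates the
  unit right ideal and such a \<open>w\<close> the unit left ideal; stable range 1, a left-right symmetric
  condition, then makes \<open>u\<close> the first row of an invertible \<open>P\<close> and \<open>w\<close> the first column of an
  invertible \<open>Q\<close> (\<open>unimodular_row_completion\<close>, \<open>unimodular_column_completion\<close>). The corner entry
  of \<open>P A Q\<close> is \<open>1\<close>, and one row and one column operation clear the entries next to it
  (\<open>pivot_one_elimination\<close>).

  To find \<open>u\<close> and \<open>w\<close>, note that \<open>A\<close> is invertible over the skew field of fractions of \<open>R\<close>, and
  the entries of its inverse have a common denominator \<open>s \<noteq> 0\<close>; that is, \<open>A B\<close> is the scalar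
  matrix \<open>s\<close> for some \<open>B\<close> over \<open>R\<close> (\<open>scalar_right_multiple\<close>, which argues inside \<open>R\<close>). Hence
  \<open>u A (B v) = u\<^sub>1 s v\<^sub>1 + u\<^sub>2 s v\<^sub>2\<close>, an expression with exactly the two terms that 2-simplicity needs
  to reach the value \<open>1\<close>.
\<close>

section \<open>Two-by-two matrices over a noncommutative ring\<close>

definition mat2 :: "'a::zero \<Rightarrow> 'a \<Rightarrow> 'a \<Rightarrow> 'a \<Rightarrow> 'a ^ 2 ^ 2" where
  "mat2 a b c d = vector [vector [a, b], vector [c, d]]"

lemma mat2_nth [simp]:
  "mat2 a b c d $ 1 $ 1 = a" "mat2 a b c d $ 1 $ 2 = b"
  "mat2 a b c d $ 2 $ 1 = c" "mat2 a b c d $ 2 $ 2 = d"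
  by (simp_all add: mat2_def)

lemma mat2_mult:
  fixes a b c d :: "'a::semiring_1"
  shows "mat2 a b c d ** mat2 a' b' c' d' =
    mat2 (a * a' + b * c') (a * b' + b * d') (c * a' + d * c') (c * b' + d * d')"
  by (simp add: vec_eq_iff forall_2 matrix_matrix_mult_def sum_2)

lemma mat2_eq_iff:
  "mat2 a b c d = mat2 a' b' c' d' \<longleftrightarrow> a = a' \<and> b = b' \<and> c = c' \<and> d = d'"
  by (auto simp: vec_eq_iff forall_2)

lemma mat2_one: "mat 1 = mat2 1 0 0 (1 :: 'a::semiring_1)"
  by (simp add: vec_eq_iff forall_2 mat_def)

lemma mat2_zero: "0 = mat2 0 0 0 (0 :: 'a::semiring_1)"
  by (simp add: vec_eq_iff forall_2)

lemma mat2_cases: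
  obtains a b c d where "A = mat2 a b c d"
proof
  show "A = mat2 (A $ 1 $ 1) (A $ 1 $ 2) (A $ 2 $ 1) (A $ 2 $ 2)"
    by (simp add: vec_eq_iff forall_2)
qed

lemma invertible_mat2I:
  fixes a b c d :: "'a::semiring_1"
  assumes "mat2 a b c d ** mat2 a' b' c' d' = mat2 1 0 0 1"
    and "mat2 a' b' c' d' ** mat2 a b c d = mat2 1 0 0 1"
  shows "invertible (mat2 a b c d)"
  using assms unfolding invertible_def mat2_one by blast

section \<open>Stable range 1 on both sides\<close>

lemma domain_inverse_commutes:
  fixes x y :: "'a::ring_1_no_zero_divisors"
  assumes "x * y = 1"
  shows "y * x = 1"
proof -
  have "x * (y * x - 1) = (x * y) * x - x"
    by (simp add: right_diff_distrib mult.assoc)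
  then have "x * (y * x - 1) = 0"
    using assms by simp
  moreover have "x \<noteq> 0"
    using assms by auto
  ultimately show ?thesis
    by simp
qed

lemma stable_range_1_right:
  fixes a b x y :: "'a::ring_1_no_zero_divisors"
  assumes sr: "stable_range_1 TYPE('a)" and one: "a * x + b * y = 1"
  obtains t g where "(a + b * t) * g = 1" "g * (a + b * t) = 1"
proof -
  have "r = a * (x * r) + b * (y * r)" for r
    using one by (simp flip: mult.assoc distrib_right)
  then have "{a * x + b * y | x y. True} = UNIV"
    by blast
  then obtain t where "range (\<lambda>r. (a + b * t) * r) = UNIV"
    using sr unfolding stable_range_1_def by blast
  then obtain g where "(a + b * t) * g = 1"
    by (metis UNIV_I imageE)
  then show thesis
    using that domain_inverse_commutes by blast
qed

text \<open>
  Stable range 1 passes to the opposite ring (Vaserstein). From a unit \<open>U = a + b y s\<close>, where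
  \<open>b y = 1 - a x\<close>, one gets an explicit factor of \<open>1\<close> on the other side:
  \<open>(x + (1 - x s) U\<inverse> (1 - a x)) (a + s (1 - x a)) = 1\<close>, because
  \<open>(1 - a x) (a + s (1 - x a)) = U (1 - x a)\<close>.
\<close>

lemma stable_range_1_left:
  fixes a b x y :: "'a::ring_1_no_zero_divisors"
  assumes sr: "stable_range_1 TYPE('a)" and one: "a * x + b * y = 1"
  obtains t g where "(x + t * y) * g = 1" "g * (x + t * y) = 1"
proof -
  have "a * x + b * y * 1 = 1"
    using one by simp
  then obtain s h where h: "h * (a + b * y * s) = 1"
    using stable_range_1_right[OF sr] by blast
  define e where "e = 1 - x * a"
  have by_eq: "b * y = 1 - a * x"
    using one by (simp add: algebra_simps)
  have "b * y * (a + s * e) = (a + b * y * s) * e"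
  proof -
    have "b * y * a = a * e"
      unfolding by_eq e_def by (simp add: algebra_simps)
    then show ?thesis
      by (simp add: distrib_left distrib_right mult.assoc)
  qed
  then have "h * (b * y * (a + s * e)) = e"
    using h by (metis mult.assoc mult_1_left)
  then have "(1 - x * s) * (h * (b * y * (a + s * e))) = e - x * s * e"
    by (simp add: left_diff_distrib)
  moreover have "x * (a + s * e) = 1 - e + x * s * e"
    unfolding e_def by (simp add: algebra_simps)
  moreover have "(x + (1 - x * s) * h * b * y) * (a + s * e) =
      x * (a + s * e) + (1 - x * s) * (h * (b * y * (a + s * e)))"
    by (simp only: distrib_right mult.assoc)
  ultimately have "(x + (1 - x * s) * h * b * y) * (a + s * e) = 1"
    by simp
  then show thesis
    using that domain_inverse_commutes by blast
qed

section \<open>Completing unimodular rows and columns\<close>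

text \<open>
  With \<open>g = a + b t\<close> a unit, the completed matrix factors as the upper triangular matrix with
  diagonal \<open>g, 1\<close> and corner \<open>b\<close>, times the elementary matrix with \<open>- t\<close> below the diagonal.
\<close>

lemma unimodular_row_completion:
  fixes a b x y :: "'a::ring_1_no_zero_divisors"
  assumes "stable_range_1 TYPE('a)" and "a * x + b * y = 1"
  obtains c d where "invertible (mat2 a b c d)"
proof -
  obtain t h where h: "(a + b * t) * h = 1" "h * (a + b * t) = 1"
    using stable_range_1_right assms by blast
  define g where "g = a + b * t"
  have a: "a = g - b * t" and g: "g * h = 1" "h * g = 1"
    using h by (simp_all add: g_def)
  have g': "g * (h * z) = z" "h * (g * z) = z" for z
    using g by (simp_all flip: mult.assoc)
  have "invertible (mat2 a b (- t) 1)"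
    by (rule invertible_mat2I[where a' = h and b' = "- (h * b)" and
          c' = "t * h" and d' = "1 - t * h * b"])
       (simp_all add: a mat2_mult mat2_eq_iff algebra_simps g g')
  then show thesis
    by (rule that)
qed

lemma unimodular_column_completion:
  fixes a b x y :: "'a::ring_1_no_zero_divisors"
  assumes "stable_range_1 TYPE('a)" and "a * x + b * y = 1"
  obtains c d where "invertible (mat2 x c y d)"
proof -
  obtain t h where h: "(x + t * y) * h = 1" "h * (x + t * y) = 1"
    using stable_range_1_left assms by blast
  define g where "g = x + t * y"
  have x: "x = g - t * y" and g: "g * h = 1" "h * g = 1"
    using h by (simp_all add: g_def)
  have g': "g * (h * z) = z" "h * (g * z) = z" for z
    using g by (simp_all flip: mult.assoc)
  have "invertible (mat2 x (- t) y 1)"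
    by (rule invertible_mat2I[where a' = h and b' = "h * t" and
          c' = "- (y * h)" and d' = "1 - y * h * t"])
       (simp_all add: x mat2_mult mat2_eq_iff algebra_simps g g')
  then show thesis
    by (rule that)
qed

lemma pivot_one_elimination:
  fixes p q r :: "'a::ring_1"
  obtains P Q :: "'a ^ 2 ^ 2" where "invertible P" "invertible Q"
    "P ** mat2 1 p q r ** Q = mat2 1 0 0 (r - q * p)"
proof
  show "invertible (mat2 1 0 (- q) 1)"
    by (rule invertible_mat2I[where a' = 1 and b' = 0 and c' = q and d' = 1])
       (simp_all add: mat2_mult)
  show "invertible (mat2 1 (- p) 0 1)"
    by (rule invertible_mat2I[where a' = 1 and b' = p and c' = 0 and d' = 1])
       (simp_all add: mat2_mult)
  show "mat2 1 0 (- q) 1 ** mat2 1 p q r ** mat2 1 (- p) 0 1 = mat2 1 0 0 (r - q * p)"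
    by (simp add: mat2_mult)
qed

section \<open>Common denominators\<close>

lemma right_ore_common_multiple:
  fixes a b :: "'a::ring_1_no_zero_divisors"
  assumes "right_ore_domain TYPE('a)" and "a \<noteq> 0" "b \<noteq> 0"
  obtains x y where "a * x = b * y" "a * x \<noteq> 0"
proof -
  have "range (\<lambda>r. a * r) \<inter> range (\<lambda>r. b * r) \<noteq> {0}"
    using assms unfolding right_ore_domain_def by blast
  moreover have "0 \<in> range (\<lambda>r. a * r) \<inter> range (\<lambda>r. b * r)"
    by (metis IntI mult_zero_right rangeI)
  ultimately obtain z where "z \<in> range (\<lambda>r. a * r)" "z \<in> range (\<lambda>r. b * r)" "z \<noteq> 0"
    by blast
  then show thesis
    using that by auto
qed

lemma right_ore_syzygy:
  fixes a b :: "'a::ring_1_no_zero_divisors"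
  assumes "right_ore_domain TYPE('a)"
  obtains x y where "a * x + b * y = 0" "x \<noteq> 0 \<or> y \<noteq> 0"
proof (cases "a = 0 \<or> b = 0")
  case True
  then show thesis
    using that[of 1 0] that[of 0 1] by auto
next
  case False
  then obtain x y where "a * x = b * y" "a * x \<noteq> 0"
    using right_ore_common_multiple assms by blast
  then show thesis
    using that[of x "- y"] by auto
qed

lemma non_zero_divisor_kernel_trivial:
  fixes a b c d x y :: "'a::ring_1"
  assumes "matrix_non_zero_divisor (mat2 a b c d)"
    and "a * x + b * y = 0" "c * x + d * y = 0"
  shows "x = 0 \<and> y = 0"
proof -
  have "mat2 a b c d ** mat2 x 0 y 0 = 0"
    using assms by (simp add: mat2_mult mat2_zero)
  then have "mat2 x 0 y 0 = 0"
    using assms unfolding matrix_non_zero_divisor_def by blast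
  then show ?thesis
    by (simp add: mat2_zero mat2_eq_iff)
qed

text \<open>
  The columns of the right factor are found separately: a syzygy of the second row of the matrix
  gives a column with image \<open>(e, 0)\<close>, one of the first row a column with image \<open>(0, f)\<close>. Both \<open>e\<close>
  and \<open>f\<close> are nonzero as the matrix has trivial kernel, so they have a common right multiple \<open>s\<close>.
\<close>

lemma scalar_right_multiple:
  fixes A :: "'a::ring_1_no_zero_divisors ^ 2 ^ 2"
  assumes ore: "right_ore_domain TYPE('a)" and A: "matrix_non_zero_divisor A"
  obtains B s where "A ** B = mat2 s 0 0 s" "s \<noteq> 0"
proof -
  obtain a b c d where abcd: "A = mat2 a b c d"
    by (rule mat2_cases)
  note kernel = non_zero_divisor_kernel_trivial[OF A[unfolded abcd]]
  obtain x y where xy: "c * x + d * y = 0" "x \<noteq> 0 \<or> y \<noteq> 0"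
    using right_ore_syzygy[OF ore] .
  obtain x' y' where xy': "a * x' + b * y' = 0" "x' \<noteq> 0 \<or> y' \<noteq> 0"
    using right_ore_syzygy[OF ore] .
  define e where "e = a * x + b * y"
  define f where "f = c * x' + d * y'"
  have "e \<noteq> 0" "f \<noteq> 0"
    using kernel xy xy' unfolding e_def f_def by blast+
  then obtain p q where pq: "e * p = f * q" "e * p \<noteq> 0"
    using right_ore_common_multiple[OF ore] by blast
  have "A ** mat2 x x' y y' = mat2 e 0 0 f"
    using xy xy' by (simp add: abcd mat2_mult e_def f_def)
  then have "A ** (mat2 x x' y y' ** mat2 p 0 0 q) = mat2 e 0 0 f ** mat2 p 0 0 q"
    by (simp only: matrix_mul_assoc)
  also have "\<dots> = mat2 (e * p) 0 0 (e * p)"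
    using pq by (simp add: mat2_mult)
  finally show thesis
    using that pq by blast
qed

lemma n_simple_2_sum:
  fixes s :: "'a::ring_1"
  assumes "n_simple 2 TYPE('a)" and "s \<noteq> 0"
  obtains u\<^sub>1 u\<^sub>2 v\<^sub>1 v\<^sub>2 where "u\<^sub>1 * s * v\<^sub>1 + u\<^sub>2 * s * v\<^sub>2 = 1"
proof -
  obtain u v :: "nat \<Rightarrow> 'a" where "(\<Sum>i<2. u i * s * v i) = 1"
    using assms unfolding n_simple_def unit_as_n_term_sum_def by blast
  then show thesis
    using that[of "u 0" "v 0" "u 1" "v 1"] by (simp add: numeral_2_eq_2)
qed

section \<open>Reduction to diagonal form\<close>

theorem theorem3:
  fixes A :: "'a::ring_1_no_zero_divisors ^ 2 ^ 2"
  assumes "ore_domain TYPE('a)"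
    and "n_simple 2 TYPE('a)"
    and "stable_range_1 TYPE('a)"
    and "matrix_non_zero_divisor A"
  shows "\<exists>(P :: 'a ^ 2 ^ 2) (Q :: 'a ^ 2 ^ 2) (a :: 'a). invertible P \<and> invertible Q \<and>
           P ** A ** Q = vector [vector [1, 0], vector [0, a]]"
proof -
  have "right_ore_domain TYPE('a)"
    using assms(1) by (simp add: ore_domain_def)
  then obtain B s where B: "A ** B = mat2 s 0 0 s" and "s \<noteq> 0"
    using scalar_right_multiple assms(4) by blast
  obtain u\<^sub>1 u\<^sub>2 v\<^sub>1 v\<^sub>2 where uv: "u\<^sub>1 * s * v\<^sub>1 + u\<^sub>2 * s * v\<^sub>2 = 1"
    using n_simple_2_sum[OF assms(2) \<open>s \<noteq> 0\<close>] .
  obtain a b c d where abcd: "A = mat2 a b c d"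
    by (rule mat2_cases)
  obtain k l m n where klmn: "B = mat2 k l m n"
    by (rule mat2_cases)
  define w\<^sub>1 where "w\<^sub>1 = k * v\<^sub>1 + l * v\<^sub>2"
  define w\<^sub>2 where "w\<^sub>2 = m * v\<^sub>1 + n * v\<^sub>2"
  \<comment> \<open>The columns \<open>w\<close> and \<open>v\<close> are padded by zeros so that \<open>w = B v\<close> is a product of square matrices.\<close>
  have "mat2 a b c d ** mat2 w\<^sub>1 0 w\<^sub>2 0 = A ** B ** mat2 v\<^sub>1 0 v\<^sub>2 0"
    by (simp add: abcd klmn mat2_mult w\<^sub>1_def w\<^sub>2_def algebra_simps)
  also have "\<dots> = mat2 (s * v\<^sub>1) 0 (s * v\<^sub>2) 0"
    by (simp add: B mat2_mult)
  finally have Aw: "a * w\<^sub>1 + b * w\<^sub>2 = s * v\<^sub>1" "c * w\<^sub>1 + d * w\<^sub>2 = s * v\<^sub>2"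
    by (simp_all add: mat2_mult mat2_eq_iff)
  have row: "u\<^sub>1 * (a * w\<^sub>1 + b * w\<^sub>2) + u\<^sub>2 * (c * w\<^sub>1 + d * w\<^sub>2) = 1"
    using uv by (simp add: Aw mult.assoc)
  then have column: "(u\<^sub>1 * a + u\<^sub>2 * c) * w\<^sub>1 + (u\<^sub>1 * b + u\<^sub>2 * d) * w\<^sub>2 = 1"
    by (simp add: algebra_simps)
  obtain u\<^sub>3 u\<^sub>4 where P: "invertible (mat2 u\<^sub>1 u\<^sub>2 u\<^sub>3 u\<^sub>4)"
    using unimodular_row_completion[OF assms(3) row] .
  obtain w\<^sub>3 w\<^sub>4 where Q: "invertible (mat2 w\<^sub>1 w\<^sub>3 w\<^sub>2 w\<^sub>4)"
    using unimodular_column_completion[OF assms(3) column] .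
  let ?P = "mat2 u\<^sub>1 u\<^sub>2 u\<^sub>3 u\<^sub>4" and ?Q = "mat2 w\<^sub>1 w\<^sub>3 w\<^sub>2 w\<^sub>4"
  have "(?P ** A ** ?Q) $ 1 $ 1 = 1"
    using column by (simp add: abcd mat2_mult)
  then obtain p q r where pqr: "?P ** A ** ?Q = mat2 1 p q r"
    by (metis mat2_cases mat2_nth(1))
  obtain P' Q' :: "'a ^ 2 ^ 2" where inv: "invertible P'" "invertible Q'"
    and elim: "P' ** mat2 1 p q r ** Q' = mat2 1 0 0 (r - q * p)"
    using pivot_one_elimination .
  have "(P' ** ?P) ** A ** (?Q ** Q') = P' ** (?P ** A ** ?Q) ** Q'"
    by (simp only: matrix_mul_assoc)
  also have "\<dots> = vector [vector [1, 0], vector [0, r - q * p]]"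
    unfolding pqr elim by (simp only: mat2_def)
  finally show ?thesis
    using invertible_mult[OF inv(1) P] invertible_mult[OF Q inv(2)] by blast
qed

end
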